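(* Let $D\geq 1$, let $r_0,r_1\in\mathbb{C}^\times$, let $\rho_-,\rho_+\in\{r_0,r_0^{-1}\}$, and let $c=(c_1,\dots,c_{D-1})$, $s=(s_0,\dots,s_{D-1})$, $\lambda=(\lambda_1,\dots,\lambda_{D-1})$, $\mu=(\mu_0,\dots,\mu_{D-1})$ be tuples of nonzero complex scalars. Let $E_D$ be a $2D$-dimensional complex vector space with ordered basis $\mathfrak{B}_E=\{b_0,a_1,b_1,\dots,a_{D-1},b_{D-1},a_D\}$. Then there exists an $\widetilde{\mathcal H}$-module structure on $E_D$ such that the matrices representing $t_0,u_0,t_1,u_1$ with respect to $\mathfrak{B}_E$ are $T_0,U_0,T_1,U_1$, respectively.
   Context: For nonzero $r_0,r_1\in\mathbb{C}$, $\widetilde{\mathcal H}=\widetilde{\mathcal H}(r_0,r_1)$ is the unital associative $\mathbb{C}$-algebra generated by $t_0,u_0,t_1,u_1$ subject to the relations (i) $(t_i-r_i)(t_i-r_i^{-1})=0$ for $i\in\{0,1\}$; (ii) $u_0^2=u_0$; (iii) $u_1^2=0$; (iv) $u_0t_0t_1u_1=0=t_1u_1u_0t_0$. For $c,r,s,\lambda,\mu\in\mathbb{C}^{\times}$ put $k(r)=r+r^{-1}$ and $$R(r,\lambda,c)=\begin{pmatrix}k(r)-\lambda^{-1}&-c\lambda^{-1}\\ c^{-1}(\lambda-k(r)+\lambda^{-1})&\lambda^{-1}\end{pmatrix},\quad P(c)=\begin{pmatrix}1&c\\0&0\end{pmatrix},$$ $$S(r,s)=\begin{pmatrix}k(r)&s\\-s^{-1}&0\end{pmatrix},\quad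 N(s,\mu)=\begin{pmatrix}0&0\\ s^{-1}\mu&0\end{pmatrix}.$$ Matrices act on coordinate column vectors. Define $T_0,U_0,T_1,U_1\in\operatorname{Mat}_{2D}(\mathbb{C})$ by $$T_0=\operatorname{blockdiag}([\rho_-],R_1,\dots,R_{D-1},[\rho_+]),\quad U_0=\operatorname{blockdiag}([0],P_1,\dots,P_{D-1},[1]),$$ $$T_1=\operatorname{blockdiag}(S_0,\dots,S_{D-1}),\quad U_1=\operatorname{blockdiag}(N_0,\dots,N_{D-1}),$$ where $R_i=R(r_0,\lambda_i,c_i)$, $P_i=P(c_i)$ for $1\le i\le D-1$ and $S_i=S(r_1,s_i)$, $N_i=N(s_i,\mu_i)$ for $0\le i\le D-1$. When $D=1$ the tuples $c,\lambda$ are empty and there are no blocks $R_i,P_i$, so $T_0=\operatorname{diag}(\rho_-,\rho_+)$, $U_0=\operatorname{diag}(0,1)$. *)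

theory Defs
  imports
    "HOL-Library.Poly_Mapping"
    "HOL-Algebra.QuotRing"
    "HOL-Algebra.Algebraic_Closure_Type"
    "Jordan_Normal_Form.Matrix"
begin

section \<open>Unital associative complex algebras and their modules\<close>

text \<open>A unital associative complex algebra is a (not necessarily commutative) ring together with a
  unital ring homomorphism \<open>\<eta>\<close> from the complex numbers into its centre; the scalar multiple
  of \<open>x\<close> by \<open>z\<close> is \<open>\<eta> z \<otimes> x\<close>.\<close>

locale complex_algebra = ring A for A (structure) +
  fixes \<eta> :: "complex \<Rightarrow> 'a"
  assumes eta_hom: "\<eta> \<in> Ring.ring_hom (ring_of_type_algebra :: complex ring) A"
    and eta_central: "x \<in> carrier A \<Longrightarrow> \<eta> z \<otimes> x = x \<otimes> \<eta> z"

text \<open>A left module structure on a given complex vector space. The last axiom says that the scalars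
  of the algebra act through the given scalar multiplication, so with \<open>act_mult\<close> every element
  acts linearly. The value of \<open>act\<close> outside the carrier is irrelevant.\<close>

locale complex_algebra_module =
  complex_algebra A \<eta> + V: vector_space scale
  for A (structure) and \<eta> and scale :: "complex \<Rightarrow> 'v::ab_group_add \<Rightarrow> 'v" +
  fixes act :: "'a \<Rightarrow> 'v \<Rightarrow> 'v"
  assumes act_add_right: "x \<in> carrier A \<Longrightarrow> act x (v + w) = act x v + act x w"
    and act_add_left: "x \<in> carrier A \<Longrightarrow> y \<in> carrier A \<Longrightarrow> act (x \<oplus> y) v = act x v + act y v"
    and act_mult: "x \<in> carrier A \<Longrightarrow> y \<in> carrier A \<Longrightarrow> act (x \<otimes> y) v = act x (act y v)"
    and act_one: "act \<one> v = v"
    and act_eta: "act (\<eta> z) v = scale z v"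

context vector_space
begin

definition ordered_basis :: "'b list \<Rightarrow> bool" where
  "ordered_basis bs \<longleftrightarrow> distinct bs \<and> independent (set bs) \<and> span (set bs) = UNIV"

text \<open>Column convention: column \<open>j\<close> of \<open>M\<close> holds the coordinates of the image of the \<open>j\<close>-th basis
  vector.\<close>

definition represented_by :: "'b list \<Rightarrow> ('b \<Rightarrow> 'b) \<Rightarrow> 'a mat \<Rightarrow> bool" where
  "represented_by bs f M \<longleftrightarrow> M \<in> carrier_mat (length bs) (length bs) \<and>
    (\<forall>j < length bs. f (bs ! j) = (\<Sum>i < length bs. scale (M $$ (i, j)) (bs ! i)))"

end

section \<open>The free algebra and the algebra presented by generators and relations\<close>

datatype 'g word = Word "'g list"

instantiation word :: (type) monoid_add
begin

definition zero_word :: "'a word" where "0 = Word []"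

fun plus_word :: "'a word \<Rightarrow> 'a word \<Rightarrow> 'a word" where
  "Word xs + Word ys = Word (xs @ ys)"

instance
proof
  fix a b c :: "'a word"
  show "a + b + c = a + (b + c)" by (cases a; cases b; cases c) simp
  show "0 + a = a" by (cases a) (simp add: zero_word_def)
  show "a + 0 = a" by (cases a) (simp add: zero_word_def)
qed

end

text \<open>The free unital associative complex algebra on \<open>'g\<close> is the monoid algebra of the free monoid
  of words, with the convolution product of \<open>Poly_Mapping\<close>.\<close>

type_synonym 'g free_alg = "'g word \<Rightarrow>\<^sub>0 complex"

definition free_gen :: "'g \<Rightarrow> 'g free_alg" where
  "free_gen g = Poly_Mapping.single (Word [g]) 1"

definition free_const :: "complex \<Rightarrow> 'g free_alg" where
  "free_const z = Poly_Mapping.single 0 z"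

abbreviation free_ring :: "'g free_alg ring" where
  "free_ring \<equiv> ring_of_type_algebra"

datatype gen = Gen_t0 | Gen_u0 | Gen_t1 | Gen_u1

definition H_relators :: "complex \<Rightarrow> complex \<Rightarrow> gen free_alg set" where
  "H_relators r0 r1 =
    (let t0 = free_gen Gen_t0; u0 = free_gen Gen_u0; t1 = free_gen Gen_t1; u1 = free_gen Gen_u1 in
      {(t0 - free_const r0) * (t0 - free_const (inverse r0)),
       (t1 - free_const r1) * (t1 - free_const (inverse r1)),
       u0 ^ 2 - u0,
       u1 ^ 2,
       u0 * t0 * t1 * u1,
       t1 * u1 * u0 * t0})"

text \<open>Ideals in \<open>HOL-Algebra\<close> are two-sided.\<close>

definition H_ideal :: "complex \<Rightarrow> complex \<Rightarrow> gen free_alg set" where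
  "H_ideal r0 r1 = Idl\<^bsub>free_ring\<^esub> (H_relators r0 r1)"

definition H_alg :: "complex \<Rightarrow> complex \<Rightarrow> gen free_alg set ring" where
  "H_alg r0 r1 = free_ring Quot (H_ideal r0 r1)"

definition H_class :: "complex \<Rightarrow> complex \<Rightarrow> gen free_alg \<Rightarrow> gen free_alg set" where
  "H_class r0 r1 p = H_ideal r0 r1 +>\<^bsub>free_ring\<^esub> p"

definition H_const :: "complex \<Rightarrow> complex \<Rightarrow> complex \<Rightarrow> gen free_alg set" where
  "H_const r0 r1 z = H_class r0 r1 (free_const z)"

definition H_gen :: "complex \<Rightarrow> complex \<Rightarrow> gen \<Rightarrow> gen free_alg set" where
  "H_gen r0 r1 g = H_class r0 r1 (free_gen g)"

lemma ring_free_ring: "ring (free_ring :: 'g free_alg ring)"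
proof -
  have "\<exists>y. x + y = 0" "\<exists>y. y + x = 0" for x :: "'g free_alg"
    by (rule exI[of _ "- x"], simp)+
  then show ?thesis
    by unfold_locales (auto simp: ring_of_type_algebra_def algebra_simps Units_def)
qed

lemma free_const_commute: "free_const z * p = p * (free_const z :: 'g free_alg)"
proof (induction p rule: update_induct)
  case const
  show ?case by simp
next
  case (update f a b)
  then have "Poly_Mapping.update a b f = f + Poly_Mapping.single a b"
    by (intro poly_mapping_eqI)
      (auto simp: Poly_Mapping.lookup_update lookup_add lookup_single in_keys_iff when_def)
  with update show ?case
    by (simp add: free_const_def distrib_left distrib_right mult_single mult.commute)
qed

lemma H_ideal_ideal: "ideal (H_ideal r0 r1) free_ring"
proof -
  interpret F: ring "free_ring :: gen free_alg ring" by (rule ring_free_ring)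
  show ?thesis unfolding H_ideal_def
    by (rule F.genideal_ideal) (simp add: ring_of_type_algebra_def)
qed

lemma complex_algebra_H: "complex_algebra (H_alg r0 r1) (H_const r0 r1)"
proof -
  interpret I: ideal "H_ideal r0 r1" free_ring by (rule H_ideal_ideal)
  interpret Q: ring "H_alg r0 r1" unfolding H_alg_def by (rule I.quotient_is_ring)
  have hom: "H_class r0 r1 \<in> Ring.ring_hom free_ring (H_alg r0 r1)"
    using I.rcos_ring_hom unfolding H_alg_def H_class_def[abs_def] .
  have const: "free_const \<in> Ring.ring_hom (ring_of_type_algebra :: complex ring)
      (free_ring :: gen free_alg ring)"
    by (rule ring_hom_memI)
      (simp_all add: ring_of_type_algebra_def free_const_def mult_single single_add)
  show ?thesis
  proof unfold_locales
    show "H_const r0 r1 \<in> Ring.ring_hom (ring_of_type_algebra :: complex ring) (H_alg r0 r1)"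
      using ring_hom_trans[OF const hom] unfolding H_const_def[abs_def] comp_def .
    fix x z assume "x \<in> carrier (H_alg r0 r1)"
    then obtain p where p: "x = H_class r0 r1 p"
      by (auto simp: H_alg_def H_class_def FactRing_def A_RCOSETS_def')
    have "H_class r0 r1 a \<otimes>\<^bsub>H_alg r0 r1\<^esub> H_class r0 r1 b = H_class r0 r1 (a * b)" for a b
      using ring_hom_mult[OF hom, of a b] by (simp add: ring_of_type_algebra_def)
    then show "H_const r0 r1 z \<otimes>\<^bsub>H_alg r0 r1\<^esub> x = x \<otimes>\<^bsub>H_alg r0 r1\<^esub> H_const r0 r1 z"
      by (simp add: p H_const_def free_const_commute)
  qed
qed

section \<open>The matrices\<close>

definition kk :: "complex \<Rightarrow> complex" where
  "kk r = r + inverse r"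

definition R_block :: "complex \<Rightarrow> complex \<Rightarrow> complex \<Rightarrow> complex mat" where
  "R_block r l c = mat_of_rows_list 2
    [[kk r - inverse l, - c * inverse l],
     [inverse c * (l - kk r + inverse l), inverse l]]"

definition P_block :: "complex \<Rightarrow> complex mat" where
  "P_block c = mat_of_rows_list 2 [[1, c], [0, 0]]"

definition S_block :: "complex \<Rightarrow> complex \<Rightarrow> complex mat" where
  "S_block r s = mat_of_rows_list 2 [[kk r, s], [- inverse s, 0]]"

definition N_block :: "complex \<Rightarrow> complex \<Rightarrow> complex mat" where
  "N_block s m = mat_of_rows_list 2 [[0, 0], [inverse s * m, 0]]"

abbreviation scalar_block :: "complex \<Rightarrow> complex mat" where
  "scalar_block z \<equiv> mat_of_rows_list 1 [[z]]"

text \<open>Tuples are functions on the naturals; only the values of \<open>c\<close>, \<open>l\<close> (the tuple \<open>\<lambda>\<close>) at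
  \<open>1, \<dots>, D - 1\<close> and of \<open>s\<close>, \<open>m\<close> (the tuple \<open>\<mu>\<close>) at \<open>0, \<dots>, D - 1\<close> are used.\<close>

definition T0_mat :: "nat \<Rightarrow> complex \<Rightarrow> complex \<Rightarrow> complex \<Rightarrow> (nat \<Rightarrow> complex) \<Rightarrow> (nat \<Rightarrow> complex)
    \<Rightarrow> complex mat" where
  "T0_mat D r0 rho_minus rho_plus c l = diag_block_mat
    ([scalar_block rho_minus] @ map (\<lambda>i. R_block r0 (l i) (c i)) [1..<D] @ [scalar_block rho_plus])"

definition U0_mat :: "nat \<Rightarrow> (nat \<Rightarrow> complex) \<Rightarrow> complex mat" where
  "U0_mat D c = diag_block_mat
    ([scalar_block 0] @ map (\<lambda>i. P_block (c i)) [1..<D] @ [scalar_block 1])"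

definition T1_mat :: "nat \<Rightarrow> complex \<Rightarrow> (nat \<Rightarrow> complex) \<Rightarrow> complex mat" where
  "T1_mat D r1 s = diag_block_mat (map (\<lambda>i. S_block r1 (s i)) [0..<D])"

definition U1_mat :: "nat \<Rightarrow> (nat \<Rightarrow> complex) \<Rightarrow> (nat \<Rightarrow> complex) \<Rightarrow> complex mat" where
  "U1_mat D s m = diag_block_mat (map (\<lambda>i. N_block (s i) (m i)) [0..<D])"

text \<open>The list \<open>b\<^sub>0, a\<^sub>1, b\<^sub>1, \<dots>, a\<^sub>D\<^sub>-\<^sub>1, b\<^sub>D\<^sub>-\<^sub>1, a\<^sub>D\<close>, of length \<open>2 * D\<close>
  for \<open>D \<ge> 1\<close>.\<close>

definition E_list :: "nat \<Rightarrow> (nat \<Rightarrow> 'v) \<Rightarrow> (nat \<Rightarrow> 'v) \<Rightarrow> 'v list" where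
  "E_list D a b = [b 0] @ concat (map (\<lambda>i. [a i, b i]) [1..<D]) @ [a D]"

end

theory Submission
  imports Defs
begin

text \<open>
  A module over an algebra presented by generators and relations is the same as a family of linear
  operators, one for each generator, that satisfy the relations. Indeed,
  operators on \<open>V\<close> extend to an action of the free algebra (evaluate each word as a composite and
  extend linearly, \<open>free_act_mult\<close>); the elements that act as zero form a two-sided
  ideal; so if the defining relators are among them, the ideal that they generate acts as zero too and
  the action descends to the quotient (\<open>H_act_class\<close>, \<open>H_act_module\<close>).

  It remains to see that the operators \<open>t\<^sub>0, u\<^sub>0, t\<^sub>1, u\<^sub>1\<close> with the given matrices satisfy the relations,
  and for this it is enough to evaluate them on basis vectors. The blocks of \<open>t\<^sub>0\<close> and \<open>u\<^sub>0\<close> pair up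
  \<open>a\<^sub>i, b\<^sub>i\<close> and leave \<open>b\<^sub>0\<close> and \<open>a\<^sub>D\<close> alone, while the blocks of \<open>t\<^sub>1\<close> and \<open>u\<^sub>1\<close> pair up
  \<open>b\<^sub>i, a\<^sub>i\<^sub>+\<^sub>1\<close>. The relations in one index hold block by block: each \<open>2 \<times> 2\<close> block of \<open>t\<^sub>i\<close> has trace
  \<open>r\<^sub>i + r\<^sub>i\<^sup>-\<^sup>1\<close> and determinant \<open>1\<close>, so the quadratic relation is the Cayley-Hamilton identity
  (\<open>quadratic_relation_on_block\<close>).

  The two mixed relations involve both pairings and come from the following three facts. The product
  \<open>u\<^sub>0 t\<^sub>0\<close> kills every \<open>b\<^sub>i\<close> with \<open>i < D\<close>: the second column of \<open>R\<^sub>i\<close> is in the kernel of \<open>P\<^sub>i\<close>, and \<open>b\<^sub>0\<close>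
  is an eigenvector of \<open>t\<^sub>0\<close> that \<open>u\<^sub>0\<close> kills. The range of \<open>t\<^sub>1 u\<^sub>1\<close> is in the span of these \<open>b\<^sub>i\<close>, because
  \<open>u\<^sub>1\<close> maps into the span of the \<open>a\<^sub>i\<close> and \<open>t\<^sub>1\<close> maps \<open>a\<^sub>i\<^sub>+\<^sub>1\<close> to a multiple of \<open>b\<^sub>i\<close>; hence
  \<open>u\<^sub>0 t\<^sub>0 t\<^sub>1 u\<^sub>1 = 0\<close>. Finally the range of \<open>u\<^sub>0\<close> is in the span of the \<open>a\<^sub>i\<close>, and \<open>u\<^sub>1\<close> kills all of these;
  hence \<open>t\<^sub>1 u\<^sub>1 u\<^sub>0 t\<^sub>0 = 0\<close>.
\<close>

section \<open>Operators representing the generators of a free algebra\<close>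

lemma free_alg_induct:
  fixes p :: "'g free_alg"
  assumes "P 0" and "\<And>p w z. P p \<Longrightarrow> P (p + Poly_Mapping.single w z)"
  shows "P p"
proof (induction p rule: update_induct)
  case const
  show ?case by (rule assms)
next
  case (update f a b)
  then have "Poly_Mapping.update a b f = f + Poly_Mapping.single a b"
    by (intro poly_mapping_eqI)
      (auto simp: Poly_Mapping.lookup_update lookup_add lookup_single in_keys_iff when_def)
  with update assms(2) show ?case by simp
qed

locale generator_operators = V: vector_space scale
  for scale :: "complex \<Rightarrow> 'v::ab_group_add \<Rightarrow> 'v" +
  fixes oper :: "'g \<Rightarrow> 'v \<Rightarrow> 'v"
  assumes linear_oper: "Vector_Spaces.linear scale scale (oper g)"
begin

fun word_act :: "'g word \<Rightarrow> 'v \<Rightarrow> 'v" where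
  "word_act (Word gs) v = foldr oper gs v"

definition free_act :: "'g free_alg \<Rightarrow> 'v \<Rightarrow> 'v" where
  "free_act p v = (\<Sum>w\<in>Poly_Mapping.keys p. scale (Poly_Mapping.lookup p w) (word_act w v))"

lemma word_act_plus: "word_act (x + y) v = word_act x (word_act y v)"
  by (cases x; cases y) simp

lemma word_act_0: "word_act 0 v = v"
  by (simp add: zero_word_def)

lemma oper_add: "oper g (v + w) = oper g v + oper g w"
  and oper_scale: "oper g (scale z v) = scale z (oper g v)"
  using linear_oper[of g] by (simp_all add: Vector_Spaces.linear_iff V.vector_space_axioms)

lemma word_act_add: "word_act x (v + w) = word_act x v + word_act x w"
proof (cases x)
  case (Word gs)
  have "foldr oper gs (v + w) = foldr oper gs v + foldr oper gs w"
    by (induction gs) (simp_all add: oper_add)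
  with Word show ?thesis by simp
qed

lemma word_act_scale: "word_act x (scale z v) = scale z (word_act x v)"
proof (cases x)
  case (Word gs)
  have "foldr oper gs (scale z v) = scale z (foldr oper gs v)"
    by (induction gs) (simp_all add: oper_scale)
  with Word show ?thesis by simp
qed

text \<open>A sum over any finite superset of the support lets the expansions of two elements be taken over
  the same index set, which is how additivity is proved.\<close>

lemma free_act_superset:
  assumes "finite S" "Poly_Mapping.keys p \<subseteq> S"
  shows "free_act p v = (\<Sum>w\<in>S. scale (Poly_Mapping.lookup p w) (word_act w v))"
  unfolding free_act_def using assms
  by (intro sum.mono_neutral_left) (auto simp: in_keys_iff)

lemma free_act_plus: "free_act (p + q) v = free_act p v + free_act q v"
proof -
  let ?S = "Poly_Mapping.keys p \<union> Poly_Mapping.keys q"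
  have "Poly_Mapping.keys (p + q) \<subseteq> ?S" by (rule Poly_Mapping.keys_add)
  then show ?thesis
    by (simp add: free_act_superset[of ?S] lookup_add V.scale_left_distrib sum.distrib)
qed

lemma free_act_0: "free_act 0 v = 0"
  by (simp add: free_act_def)

lemma free_act_minus: "free_act (p - q) v = free_act p v - free_act q v"
  using free_act_plus[of "p - q" q v] by (simp add: algebra_simps)

lemma free_act_single: "free_act (Poly_Mapping.single w z) v = scale z (word_act w v)"
  by (simp add: free_act_def)

lemma free_act_add: "free_act p (v + w) = free_act p v + free_act p w"
  by (simp add: free_act_def word_act_add V.scale_right_distrib sum.distrib)

lemma free_act_scale: "free_act p (scale z v) = scale z (free_act p v)"
  by (simp add: free_act_def word_act_scale V.scale_sum_right mult.commute)

lemma free_act_const: "free_act (free_const z) v = scale z v"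
  by (simp add: free_const_def free_act_single word_act_0)

lemma free_act_gen: "free_act (free_gen g) v = oper g v"
  by (simp add: free_gen_def free_act_single)

lemma free_act_zero_right: "free_act p 0 = 0"
  using free_act_add[of p 0 0] by simp

text \<open>Both sides are additive in \<open>p\<close> and in \<open>q\<close>, so it is enough to compare them on single words, where
  concatenation of words is composition of operators.\<close>

lemma free_act_mult: "free_act (p * q) v = free_act p (free_act q v)"
proof (induction p rule: free_alg_induct)
  case 1
  show ?case by (simp add: free_act_0)
next
  case (2 p w z)
  have "free_act (Poly_Mapping.single w z * q) v
      = free_act (Poly_Mapping.single w z) (free_act q v)"
  proof (induction q rule: free_alg_induct)
    case 1
    show ?case by (simp add: free_act_0 free_act_zero_right)
  next
    case (2 q x y)
    then show ?case
      by (simp add: distrib_left mult_single free_act_plus free_act_add free_act_single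
          word_act_plus word_act_scale)
  qed
  with 2 show ?case by (simp add: distrib_right free_act_plus)
qed

definition annihilator :: "'g free_alg set" where
  "annihilator = {p. \<forall>v. free_act p v = 0}"

lemma ideal_annihilator: "ideal annihilator free_ring"
proof (rule idealI)
  interpret F: ring "free_ring :: 'g free_alg ring" by (rule ring_free_ring)
  show "ring (free_ring :: 'g free_alg ring)" by (rule ring_free_ring)
  have inv: "\<ominus>\<^bsub>free_ring\<^esub> p = - p" for p :: "'g free_alg"
    by (rule F.minus_equality) (simp_all add: ring_of_type_algebra_def)
  show "subgroup annihilator (add_monoid free_ring)"
  proof
    fix p assume "p \<in> annihilator"
    then have "- p \<in> annihilator"
      using free_act_minus[of 0 p] by (simp add: annihilator_def free_act_0)
    then show "inv\<^bsub>add_monoid free_ring\<^esub> p \<in> annihilator"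
      using inv[of p] by (simp add: a_inv_def)
  qed (auto simp: annihilator_def ring_of_type_algebra_def free_act_plus free_act_0)
qed (auto simp: annihilator_def ring_of_type_algebra_def free_act_mult free_act_zero_right)

end

section \<open>Modules over the presented algebra\<close>

text \<open>The six assumptions are the defining relations, read as identities between operators. The
  quadratic ones keep the factored form \<open>(t - r) (t - r\<^sup>-\<^sup>1)\<close> of the relators, applied to a vector.\<close>

locale H_operators = generator_operators scale oper
  for scale :: "complex \<Rightarrow> 'v::ab_group_add \<Rightarrow> 'v" and oper :: "gen \<Rightarrow> 'v \<Rightarrow> 'v" +
  fixes r0 r1 :: complex
  assumes t0_quadratic: "oper Gen_t0 (oper Gen_t0 v - scale (inverse r0) v)
        - scale r0 (oper Gen_t0 v - scale (inverse r0) v) = 0"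
    and t1_quadratic: "oper Gen_t1 (oper Gen_t1 v - scale (inverse r1) v)
        - scale r1 (oper Gen_t1 v - scale (inverse r1) v) = 0"
    and u0_idempotent: "oper Gen_u0 (oper Gen_u0 v) = oper Gen_u0 v"
    and u1_square_zero: "oper Gen_u1 (oper Gen_u1 v) = 0"
    and u0t0t1u1: "oper Gen_u0 (oper Gen_t0 (oper Gen_t1 (oper Gen_u1 v))) = 0"
    and t1u1u0t0: "oper Gen_t1 (oper Gen_u1 (oper Gen_u0 (oper Gen_t0 v))) = 0"
begin

lemma relators: "H_relators r0 r1 \<subseteq> annihilator"
  by (simp add: H_relators_def Let_def annihilator_def free_act_mult free_act_minus free_act_gen
      free_act_const power2_eq_square t0_quadratic t1_quadratic u0_idempotent u1_square_zero
      u0t0t1u1 t1u1u0t0)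

text \<open>A residue class acts through a representative, and \<open>H_act_class\<close> says that the choice does not
  matter.\<close>

definition H_act :: "gen free_alg set \<Rightarrow> 'v \<Rightarrow> 'v" where
  "H_act x v = free_act (SOME p. p \<in> x) v"

text \<open>Two representatives differ by an element of the ideal generated by the relators. This ideal is
  contained in the annihilator, which is itself an ideal containing the relators.\<close>

lemma H_act_class: "H_act (H_class r0 r1 p) v = free_act p v"
proof -
  interpret F: ring "free_ring :: gen free_alg ring" by (rule ring_free_ring)
  interpret I: ideal "H_ideal r0 r1" free_ring by (rule H_ideal_ideal)
  have ann: "H_ideal r0 r1 \<subseteq> annihilator"
    unfolding H_ideal_def by (rule F.genideal_minimal[OF ideal_annihilator relators])
  have "p \<in> H_class r0 r1 p"
    unfolding H_class_def by (rule I.a_rcos_self) (simp add: ring_of_type_algebra_def)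
  then have "(SOME q. q \<in> H_class r0 r1 p) \<in> H_class r0 r1 p" by (rule someI)
  then obtain i where "i \<in> H_ideal r0 r1" "(SOME q. q \<in> H_class r0 r1 p) = i + p"
    by (auto simp: H_class_def a_r_coset_def' ring_of_type_algebra_def)
  moreover from this ann have "free_act i v = 0" by (auto simp: annihilator_def)
  ultimately show ?thesis by (simp add: H_act_def free_act_plus)
qed

lemma H_act_gen: "H_act (H_gen r0 r1 g) = oper g"
  by (rule ext) (simp add: H_gen_def H_act_class free_act_gen)

lemma H_act_module: "complex_algebra_module (H_alg r0 r1) (H_const r0 r1) scale H_act"
proof -
  interpret A: complex_algebra "H_alg r0 r1" "H_const r0 r1" by (rule complex_algebra_H)
  interpret I: ideal "H_ideal r0 r1" free_ring by (rule H_ideal_ideal)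
  have hom: "H_class r0 r1 \<in> Ring.ring_hom free_ring (H_alg r0 r1)"
    using I.rcos_ring_hom unfolding H_alg_def H_class_def[abs_def] .
  have class_mult: "H_class r0 r1 p \<otimes>\<^bsub>H_alg r0 r1\<^esub> H_class r0 r1 q = H_class r0 r1 (p * q)" for p q
    using ring_hom_mult[OF hom, of p q] by (simp add: ring_of_type_algebra_def)
  have class_add: "H_class r0 r1 p \<oplus>\<^bsub>H_alg r0 r1\<^esub> H_class r0 r1 q = H_class r0 r1 (p + q)" for p q
    using ring_hom_add[OF hom, of p q] by (simp add: ring_of_type_algebra_def)
  have class_one: "\<one>\<^bsub>H_alg r0 r1\<^esub> = H_class r0 r1 (free_const 1)"
    using ring_hom_one[OF hom] by (simp add: ring_of_type_algebra_def free_const_def)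
  have class_ex: "\<exists>p. x = H_class r0 r1 p" if "x \<in> carrier (H_alg r0 r1)" for x
    using that by (auto simp: H_alg_def H_class_def FactRing_def A_RCOSETS_def')
  show ?thesis
  proof unfold_locales
    fix x v w assume "x \<in> carrier (H_alg r0 r1)"
    then show "H_act x (v + w) = H_act x v + H_act x w"
      using class_ex by (metis H_act_class free_act_add)
  next
    fix x y v assume "x \<in> carrier (H_alg r0 r1)" "y \<in> carrier (H_alg r0 r1)"
    then obtain p q where "x = H_class r0 r1 p" "y = H_class r0 r1 q" using class_ex by metis
    then show "H_act (x \<oplus>\<^bsub>H_alg r0 r1\<^esub> y) v = H_act x v + H_act y v"
      and "H_act (x \<otimes>\<^bsub>H_alg r0 r1\<^esub> y) v = H_act x (H_act y v)"
      by (simp_all add: class_add class_mult H_act_class free_act_plus free_act_mult)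
  qed (simp_all add: class_one H_act_class H_const_def free_act_const)
qed

end

section \<open>Linear maps given by block diagonal matrices\<close>

lemma sum_lessThan_add:
  fixes h :: "nat \<Rightarrow> 'c::comm_monoid_add"
  shows "(\<Sum>i<k + n. h i) = (\<Sum>i<k. h i) + (\<Sum>i<n. h (k + i))"
  by (induction n) (simp_all add: add.assoc)

context vector_space
begin

text \<open>Being represented by a matrix is one condition for each column. In a block diagonal matrix the zero
  blocks confine each of these conditions to one part of the list.\<close>

lemma represented_by_four_block:
  assumes A: "A \<in> carrier_mat (length bs) (length bs)"
    and B: "B \<in> carrier_mat (length cs) (length cs)"
  shows "represented_by (bs @ cs) f
      (four_block_mat A (0\<^sub>m (length bs) (length cs)) (0\<^sub>m (length cs) (length bs)) B) \<longleftrightarrow>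
    represented_by bs f A \<and> represented_by cs f B"
proof -
  let ?m = "length bs" and ?n = "length cs"
  let ?M = "four_block_mat A (0\<^sub>m ?m ?n) (0\<^sub>m ?n ?m) B"
  have dims: "dim_row A = ?m" "dim_col A = ?m" "dim_row B = ?n" "dim_col B = ?n"
    using A B by auto
  have split: "(\<Sum>i<?m + ?n. h i) = (\<Sum>i<?m. h i) + (\<Sum>i<?n. h (?m + i))" for h :: "nat \<Rightarrow> 'b"
    by (rule sum_lessThan_add)
  have left: "(\<Sum>i<?m + ?n. scale (?M $$ (i, j)) ((bs @ cs) ! i))
      = (\<Sum>i<?m. scale (A $$ (i, j)) (bs ! i))"
    if "j < ?m" for j
    using that by (simp add: split dims nth_append)
  have right: "(\<Sum>i<?m + ?n. scale (?M $$ (i, ?m + j)) ((bs @ cs) ! i))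
      = (\<Sum>i<?n. scale (B $$ (i, j)) (cs ! i))"
    if "j < ?n" for j
    using that by (simp add: split dims nth_append)
  have all_split: "(\<forall>j<?m + ?n. Q j) \<longleftrightarrow> (\<forall>j<?m. Q j) \<and> (\<forall>j<?n. Q (?m + j))" for Q
  proof (intro iffI allI impI; (elim conjE)?)
    fix j assume "\<forall>j<?m. Q j" "\<forall>j<?n. Q (?m + j)" "j < ?m + ?n"
    then show "Q j" by (cases "j < ?m") (auto dest: spec[of _ "j - ?m"])
  qed auto
  show ?thesis
    using A B unfolding represented_by_def length_append all_split
    by (simp add: left right nth_append_left del: index_mat_four_block)
qed

lemma represented_by_diag_block:
  assumes "list_all2 (\<lambda>bs A. A \<in> carrier_mat (length bs) (length bs)) bss As"
  shows "represented_by (concat bss) f (diag_block_mat As) \<longleftrightarrow>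
      list_all2 (\<lambda>bs A. represented_by bs f A) bss As"
    and "diag_block_mat As \<in> carrier_mat (length (concat bss)) (length (concat bss))"
proof -
  have "(represented_by (concat bss) f (diag_block_mat As) \<longleftrightarrow>
      list_all2 (\<lambda>bs A. represented_by bs f A) bss As)
    \<and> diag_block_mat As \<in> carrier_mat (length (concat bss)) (length (concat bss))"
    using assms
  proof (induction rule: list_all2_induct)
    case Nil
    show ?case by (simp add: represented_by_def)
  next
    case (Cons bs bss A As)
    then have "dim_row A = length bs" "dim_col A = length bs"
      "dim_row (diag_block_mat As) = length (concat bss)"
      "dim_col (diag_block_mat As) = length (concat bss)" by auto
    with Cons represented_by_four_block[of A bs "diag_block_mat As" "concat bss" f]
    show ?case by (simp add: Let_def)
  qed
  then show "represented_by (concat bss) f (diag_block_mat As) \<longleftrightarrow>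
      list_all2 (\<lambda>bs A. represented_by bs f A) bss As"
    and "diag_block_mat As \<in> carrier_mat (length (concat bss)) (length (concat bss))" by auto
qed

lemma represented_by_1:
  "represented_by [x] f (mat_of_rows_list 1 [[p]]) \<longleftrightarrow> f x = scale p x"
  by (simp add: represented_by_def mat_of_rows_list_def)

lemma represented_by_2:
  "represented_by [x, y] f (mat_of_rows_list 2 [[p, q], [r, s]]) \<longleftrightarrow>
    f x = scale p x + scale r y \<and> f y = scale q x + scale s y"
  by (auto simp: represented_by_def mat_of_rows_list_def less_Suc_eq numeral_2_eq_2)

text \<open>The elements of the list are pairwise distinct, so a column can be assigned to a basis vector by
  inverting the indexing.\<close>

lemma represented_by_exists:
  assumes "ordered_basis bs" and M: "M \<in> carrier_mat (length bs) (length bs)"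
  shows "\<exists>f. Vector_Spaces.linear scale scale f \<and> represented_by bs f M"
proof -
  interpret P: vector_space_pair scale scale ..
  have bs: "distinct bs" "independent (set bs)" using assms(1) by (auto simp: ordered_basis_def)
  let ?h = "\<lambda>j. \<Sum>i<length bs. scale (M $$ (i, j)) (bs ! i)"
  obtain f where f: "Vector_Spaces.linear scale scale f"
    and fh: "\<And>x. x \<in> set bs \<Longrightarrow> f x = ?h (the_inv_into {..<length bs} ((!) bs) x)"
    using P.linear_independent_extend[OF bs(2), of "\<lambda>x. ?h (the_inv_into {..<length bs} ((!) bs) x)"]
    by blast
  have "the_inv_into {..<length bs} ((!) bs) (bs ! j) = j" if "j < length bs" for j
    using that bs(1) by (intro the_inv_into_f_f inj_on_nth) auto
  with f fh M show ?thesis by (auto simp: represented_by_def)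
qed

lemma linear_zero_on_basis:
  assumes "ordered_basis bs" "Vector_Spaces.linear scale scale f" "\<And>x. x \<in> set bs \<Longrightarrow> f x = 0"
  shows "f v = 0"
proof -
  interpret P: vector_space_pair scale scale ..
  have "v \<in> span (set bs)" using assms(1) by (simp add: ordered_basis_def)
  from P.linear_eq_on[OF assms(2) P.linear_zero this] assms(3) show ?thesis by simp
qed

text \<open>This is the Cayley-Hamilton identity for a \<open>2 \<times> 2\<close> block with columns \<open>(p, w)\<close> and \<open>(q, s)\<close>, whose
  trace and determinant make \<open>r\<close> and \<open>r'\<close> the roots of its characteristic polynomial.\<close>

lemma quadratic_relation_on_block:
  assumes f: "Vector_Spaces.linear scale scale f"
    and x: "f x = scale p x + scale w y" and y: "f y = scale q x + scale s y"
    and tr: "p + s = r + r'" and det: "p * s - q * w = r * r'"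
  shows "f (f x - scale r' x) - scale r (f x - scale r' x) = 0"
    and "f (f y - scale r' y) - scale r (f y - scale r' y) = 0"
proof -
  interpret f: Vector_Spaces.linear scale scale f by (rule f)
  have "f (f x - scale r' x) - scale r (f x - scale r' x)
      = scale (p * p + q * w - (r + r') * p + r * r') x + scale (w * (p + s - (r + r'))) y"
    by (simp add: x y f.add f.diff f.scale algebra_simps)
  also have "\<dots> = 0"
    unfolding tr[symmetric] det[symmetric] by (simp add: algebra_simps)
  finally show "f (f x - scale r' x) - scale r (f x - scale r' x) = 0" .
  have "f (f y - scale r' y) - scale r (f y - scale r' y)
      = scale (q * (p + s - (r + r'))) x + scale (s * s + q * w - (r + r') * s + r * r') y"
    by (simp add: x y f.add f.diff f.scale algebra_simps)
  also have "\<dots> = 0"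
    unfolding tr[symmetric] det[symmetric] by (simp add: algebra_simps)
  finally show "f (f y - scale r' y) - scale r (f y - scale r' y) = 0" .
qed

end

section \<open>The two block decompositions of the basis\<close>

lemma E_list_ends: "E_list D a b = concat ([[b 0]] @ map (\<lambda>i. [a i, b i]) [1..<D] @ [[a D]])"
  by (simp add: E_list_def)

lemma E_list_pairs:
  assumes "D \<ge> 1"
  shows "E_list D a b = concat (map (\<lambda>i. [b i, a (Suc i)]) [0..<D])"
  using assms
proof (induction D rule: dec_induct)
  case base
  show ?case by (simp add: E_list_def)
next
  case (step D)
  then show ?case by (simp add: E_list_def)
qed

context vector_space
begin

text \<open>The equivalences turn the matrices into formulas for the operators on basis vectors; the
  dimension statements feed \<open>represented_by_exists\<close>.\<close>

lemma represented_by_ends: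
  fixes F :: "nat \<Rightarrow> 'a mat"
  assumes "\<And>i. F i \<in> carrier_mat 2 2"
  shows "represented_by (E_list D x y) f
      (diag_block_mat ([mat_of_rows_list 1 [[p]]] @ map F [1..<D] @ [mat_of_rows_list 1 [[q]]]))
    \<longleftrightarrow> f (y 0) = scale p (y 0) \<and> (\<forall>i\<in>{1..<D}. represented_by [x i, y i] f (F i))
      \<and> f (x D) = scale q (x D)"
    and "diag_block_mat ([mat_of_rows_list 1 [[p]]] @ map F [1..<D] @ [mat_of_rows_list 1 [[q]]])
      \<in> carrier_mat (length (E_list D x y)) (length (E_list D x y))"
proof -
  have *: "list_all2 (\<lambda>bs A. A \<in> carrier_mat (length bs) (length bs))
      ([[y 0]] @ map (\<lambda>i. [x i, y i]) [1..<D] @ [[x D]])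
      ([mat_of_rows_list 1 [[p]]] @ map F [1..<D] @ [mat_of_rows_list 1 [[q]]])"
    using assms by (auto intro!: list_all2_appendI simp: list_all2_map1 list_all2_map2 list_all2_same
        mat_of_rows_list_def numeral_2_eq_2)
  show "represented_by (E_list D x y) f
      (diag_block_mat ([mat_of_rows_list 1 [[p]]] @ map F [1..<D] @ [mat_of_rows_list 1 [[q]]]))
    \<longleftrightarrow> f (y 0) = scale p (y 0) \<and> (\<forall>i\<in>{1..<D}. represented_by [x i, y i] f (F i))
      \<and> f (x D) = scale q (x D)"
    unfolding E_list_ends represented_by_diag_block(1)[OF *]
    by (simp add: list_all2_append list_all2_map1 list_all2_map2 list_all2_same
        represented_by_1[simplified])
  show "diag_block_mat ([mat_of_rows_list 1 [[p]]] @ map F [1..<D] @ [mat_of_rows_list 1 [[q]]])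
      \<in> carrier_mat (length (E_list D x y)) (length (E_list D x y))"
    unfolding E_list_ends by (rule represented_by_diag_block(2)[OF *])
qed

lemma represented_by_pairs:
  fixes F :: "nat \<Rightarrow> 'a mat"
  assumes "D \<ge> 1" "\<And>i. F i \<in> carrier_mat 2 2"
  shows "represented_by (E_list D x y) f (diag_block_mat (map F [0..<D]))
    \<longleftrightarrow> (\<forall>i<D. represented_by [y i, x (Suc i)] f (F i))"
    and "diag_block_mat (map F [0..<D]) \<in> carrier_mat (length (E_list D x y)) (length (E_list D x y))"
proof -
  have *: "list_all2 (\<lambda>bs A. A \<in> carrier_mat (length bs) (length bs))
      (map (\<lambda>i. [y i, x (Suc i)]) [0..<D]) (map F [0..<D])"
    using assms by (simp add: list_all2_map1 list_all2_map2 list_all2_same numeral_2_eq_2)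
  show "represented_by (E_list D x y) f (diag_block_mat (map F [0..<D]))
    \<longleftrightarrow> (\<forall>i<D. represented_by [y i, x (Suc i)] f (F i))"
    unfolding E_list_pairs[OF assms(1)] represented_by_diag_block(1)[OF *]
    by (auto simp add: list_all2_map1 list_all2_map2 list_all2_same)
  show "diag_block_mat (map F [0..<D]) \<in> carrier_mat (length (E_list D x y)) (length (E_list D x y))"
    unfolding E_list_pairs[OF assms(1)] by (rule represented_by_diag_block(2)[OF *])
qed

end

section \<open>The relations on basis vectors\<close>

lemma block_carrier:
  "R_block r z w \<in> carrier_mat 2 2" "P_block w \<in> carrier_mat 2 2"
  "S_block r z \<in> carrier_mat 2 2" "N_block z w \<in> carrier_mat 2 2"
  by (simp_all add: R_block_def P_block_def S_block_def N_block_def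
      mat_of_rows_list_def numeral_2_eq_2)

theorem proposition3p3:
  fixes D :: nat
    and r0 r1 rho_minus rho_plus :: complex
    and c s l m :: "nat \<Rightarrow> complex"
    and scale :: "complex \<Rightarrow> 'v::ab_group_add \<Rightarrow> 'v"
    and a b :: "nat \<Rightarrow> 'v"
  assumes "D \<ge> 1"
    and "r0 \<noteq> 0" and "r1 \<noteq> 0"
    and "rho_minus \<in> {r0, inverse r0}" and "rho_plus \<in> {r0, inverse r0}"
    and "\<And>i. 1 \<le> i \<Longrightarrow> i \<le> D - 1 \<Longrightarrow> c i \<noteq> 0"
    and "\<And>i. 1 \<le> i \<Longrightarrow> i \<le> D - 1 \<Longrightarrow> l i \<noteq> 0"
    and "\<And>i. i \<le> D - 1 \<Longrightarrow> s i \<noteq> 0"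
    and "\<And>i. i \<le> D - 1 \<Longrightarrow> m i \<noteq> 0"
    and "vector_space scale"
    and "vector_space.dim scale (UNIV :: 'v set) = 2 * D"
    and "vector_space.ordered_basis scale (E_list D a b)"
  shows "\<exists>act :: gen free_alg set \<Rightarrow> 'v \<Rightarrow> 'v.
    complex_algebra_module (H_alg r0 r1) (H_const r0 r1) scale act \<and>
    vector_space.represented_by scale (E_list D a b) (act (H_gen r0 r1 Gen_t0))
      (T0_mat D r0 rho_minus rho_plus c l) \<and>
    vector_space.represented_by scale (E_list D a b) (act (H_gen r0 r1 Gen_u0)) (U0_mat D c) \<and>
    vector_space.represented_by scale (E_list D a b) (act (H_gen r0 r1 Gen_t1)) (T1_mat D r1 s) \<and>
    vector_space.represented_by scale (E_list D a b) (act (H_gen r0 r1 Gen_u1)) (U1_mat D s m)"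
proof -
  interpret V: vector_space scale by fact
  let ?E = "E_list D a b"
  have basis: "V.ordered_basis ?E" by fact
  have "\<exists>f. Vector_Spaces.linear scale scale f \<and>
      V.represented_by ?E f (T0_mat D r0 rho_minus rho_plus c l)"
    unfolding T0_mat_def
    by (rule V.represented_by_exists[OF basis V.represented_by_ends(2)[OF block_carrier(1)]])
  then obtain t0 where t0: "Vector_Spaces.linear scale scale t0"
    and t0_rep: "V.represented_by ?E t0 (T0_mat D r0 rho_minus rho_plus c l)" by blast
  have "\<exists>f. Vector_Spaces.linear scale scale f \<and> V.represented_by ?E f (U0_mat D c)"
    unfolding U0_mat_def
    by (rule V.represented_by_exists[OF basis V.represented_by_ends(2)[OF block_carrier(2)]])
  then obtain u0 where u0: "Vector_Spaces.linear scale scale u0"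
    and u0_rep: "V.represented_by ?E u0 (U0_mat D c)" by blast
  have "\<exists>f. Vector_Spaces.linear scale scale f \<and> V.represented_by ?E f (T1_mat D r1 s)"
    unfolding T1_mat_def
    by (rule V.represented_by_exists[OF basis V.represented_by_pairs(2)[OF assms(1) block_carrier(3)]])
  then obtain t1 where t1: "Vector_Spaces.linear scale scale t1"
    and t1_rep: "V.represented_by ?E t1 (T1_mat D r1 s)" by blast
  have "\<exists>f. Vector_Spaces.linear scale scale f \<and> V.represented_by ?E f (U1_mat D s m)"
    unfolding U1_mat_def
    by (rule V.represented_by_exists[OF basis V.represented_by_pairs(2)[OF assms(1) block_carrier(4)]])
  then obtain u1 where u1: "Vector_Spaces.linear scale scale u1"
    and u1_rep: "V.represented_by ?E u1 (U1_mat D s m)" by blast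
  interpret t0: Vector_Spaces.linear scale scale t0 by (rule t0)
  interpret u0: Vector_Spaces.linear scale scale u0 by (rule u0)
  interpret t1: Vector_Spaces.linear scale scale t1 by (rule t1)
  interpret u1: Vector_Spaces.linear scale scale u1 by (rule u1)

  have t0_ends: "t0 (b 0) = scale rho_minus (b 0)" "t0 (a D) = scale rho_plus (a D)"
    and t0_blocks: "\<And>i. i \<in> {1..<D} \<Longrightarrow>
      t0 (a i) = scale (kk r0 - inverse (l i)) (a i)
        + scale (inverse (c i) * (l i - kk r0 + inverse (l i))) (b i) \<and>
      t0 (b i) = scale (- c i * inverse (l i)) (a i) + scale (inverse (l i)) (b i)"
    using t0_rep unfolding T0_mat_def V.represented_by_ends(1)[OF block_carrier(1)]
    by (simp_all only: R_block_def V.represented_by_2 ball_simps)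
  have u0_ends: "u0 (b 0) = 0" "u0 (a D) = a D"
    and u0_blocks: "\<And>i. i \<in> {1..<D} \<Longrightarrow> u0 (a i) = a i \<and> u0 (b i) = scale (c i) (a i)"
    using u0_rep unfolding U0_mat_def V.represented_by_ends(1)[OF block_carrier(2)]
    by (simp_all add: P_block_def V.represented_by_2)
  have t1_blocks: "\<And>i. i < D \<Longrightarrow>
      t1 (b i) = scale (kk r1) (b i) + scale (- inverse (s i)) (a (Suc i)) \<and>
      t1 (a (Suc i)) = scale (s i) (b i) + scale 0 (a (Suc i))"
    using t1_rep unfolding T1_mat_def V.represented_by_pairs(1)[OF assms(1) block_carrier(3)]
    by (simp only: S_block_def V.represented_by_2)
  have u1_blocks: "\<And>i. i < D \<Longrightarrow>
      u1 (b i) = scale (inverse (s i) * m i) (a (Suc i)) \<and> u1 (a (Suc i)) = 0"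
    using u1_rep unfolding U1_mat_def V.represented_by_pairs(1)[OF assms(1) block_carrier(4)]
    by (simp add: N_block_def V.represented_by_2)

  \<comment> \<open>Each relation is checked on whichever of the two groupings of the basis fits the operator that
    is applied first.\<close>
  have set_ends: "set ?E = {b 0, a D} \<union> (\<Union>i\<in>{1..<D}. {a i, b i})"
    unfolding E_list_ends by auto
  have set_pairs: "set ?E = (\<Union>i\<in>{..<D}. {b i, a (Suc i)})"
    unfolding E_list_pairs[OF assms(1)] by auto
  have zero_ends: "f v = 0" if "Vector_Spaces.linear scale scale f" "f (b 0) = 0" "f (a D) = 0"
    "\<And>i. i \<in> {1..<D} \<Longrightarrow> f (a i) = 0 \<and> f (b i) = 0" for f v
    using V.linear_zero_on_basis[OF basis that(1)] that(2-) unfolding set_ends by blast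
  have zero_pairs: "f v = 0" if "Vector_Spaces.linear scale scale f"
    "\<And>i. i < D \<Longrightarrow> f (b i) = 0 \<and> f (a (Suc i)) = 0" for f v
    using V.linear_zero_on_basis[OF basis that(1)] that(2-) unfolding set_pairs by blast

  let ?q0 = "\<lambda>v. t0 (t0 v - scale (inverse r0) v) - scale r0 (t0 v - scale (inverse r0) v)"
  have t0_quadratic: "?q0 v = 0" for v
  proof (rule zero_ends[where f = ?q0])
    show "Vector_Spaces.linear scale scale ?q0"
      by (simp add: Vector_Spaces.linear_iff V.vector_space_axioms t0.add t0.diff t0.scale
          V.scale_right_diff_distrib V.scale_right_distrib mult.commute)
    \<comment> \<open>On the two one-dimensional blocks \<open>t\<^sub>0\<close> acts as a root of its quadratic polynomial.\<close>
    have root: "scale z (scale z x - scale (inverse r0) x)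
        - scale r0 (scale z x - scale (inverse r0) x) = 0" if "z \<in> {r0, inverse r0}" for z x
      using that by (auto simp: V.scale_right_diff_distrib mult.commute)
    show "?q0 (b 0) = 0" "?q0 (a D) = 0"
      using root[OF assms(4), of "b 0"] root[OF assms(5), of "a D"]
      by (simp_all add: t0_ends t0.diff t0.scale V.scale_right_diff_distrib mult.commute)
    fix i assume i: "i \<in> {1..<D}"
    then have nz: "c i \<noteq> 0" "l i \<noteq> 0" using assms(6,7) by auto
    have tr: "(kk r0 - inverse (l i)) + inverse (l i) = r0 + inverse r0"
      by (simp add: kk_def)
    \<comment> \<open>The lower left entry of \<open>R\<close> is the one that makes the determinant equal to \<open>1\<close>.\<close>
    have det: "(kk r0 - inverse (l i)) * inverse (l i)
        - (- c i * inverse (l i)) * (inverse (c i) * (l i - kk r0 + inverse (l i)))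
      = r0 * inverse r0"
    proof -
      have cancel: "(- c i * inverse (l i)) * (inverse (c i) * z) = - (inverse (l i) * z)" for z
        using nz(1) by simp
      show ?thesis
        unfolding cancel
        using nz(2) assms(2) by (simp add: algebra_simps)
    qed
    show "?q0 (a i) = 0 \<and> ?q0 (b i) = 0"
      using V.quadratic_relation_on_block[OF t0 conjunct1[OF t0_blocks[OF i]]
          conjunct2[OF t0_blocks[OF i]] tr det] by blast
  qed
  let ?q1 = "\<lambda>v. t1 (t1 v - scale (inverse r1) v) - scale r1 (t1 v - scale (inverse r1) v)"
  have t1_quadratic: "?q1 v = 0" for v
  proof (rule zero_pairs[where f = ?q1])
    show "Vector_Spaces.linear scale scale ?q1"
      by (simp add: Vector_Spaces.linear_iff V.vector_space_axioms t1.add t1.diff t1.scale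
          V.scale_right_diff_distrib V.scale_right_distrib mult.commute)
    fix i assume i: "i < D"
    then have "s i \<noteq> 0" using assms(8) by auto
    then show "?q1 (b i) = 0 \<and> ?q1 (a (Suc i)) = 0"
      using assms(3) V.quadratic_relation_on_block[OF t1 conjunct1[OF t1_blocks[OF i]]
          conjunct2[OF t1_blocks[OF i]], of r1 "inverse r1"]
      by (simp add: kk_def)
  qed
  have u0_idempotent: "u0 (u0 v) - u0 v = 0" for v
    by (rule zero_ends[where f = "\<lambda>v. u0 (u0 v) - u0 v"])
      (simp_all add: Vector_Spaces.linear_iff V.vector_space_axioms u0.add u0.scale
        V.scale_right_diff_distrib u0_ends u0_blocks)
  have u1_square_zero: "u1 (u1 v) = 0" for v
    by (rule zero_pairs[where f = "\<lambda>v. u1 (u1 v)"])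
      (simp_all add: Vector_Spaces.linear_iff V.vector_space_axioms u1.add u1.scale u1_blocks)
  \<comment> \<open>On the blocks, \<open>P R\<close> has second column \<open>- c \<lambda>\<^sup>-\<^sup>1 + c \<lambda>\<^sup>-\<^sup>1 = 0\<close>.\<close>
  have u0t0_b: "u0 (t0 (b i)) = 0" if "i < D" for i
  proof (cases "i = 0")
    case True
    then show ?thesis by (simp add: t0_ends u0_ends u0.scale)
  next
    case False
    with that have "i \<in> {1..<D}" by simp
    then show ?thesis
      by (simp add: t0_blocks u0_blocks u0.diff u0.scale mult.commute)
  qed
  have u0t0t1u1: "u0 (t0 (t1 (u1 v))) = 0" for v
    by (rule zero_pairs[where f = "\<lambda>v. u0 (t0 (t1 (u1 v)))"])
      (simp_all add: Vector_Spaces.linear_iff V.vector_space_axioms u0.add u0.scale t0.add t0.scale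
        t1.add t1.scale u1.add u1.scale u1_blocks t1_blocks u0t0_b)
  have u1_a: "u1 (a i) = 0" if "i \<in> {1..D}" for i
    using that u1_blocks[of "i - 1"] by auto
  have u1_aD: "u1 (a D) = 0" using assms(1) by (intro u1_a) simp
  have t1u1u0t0: "t1 (u1 (u0 (t0 v))) = 0" for v
    by (rule zero_ends[where f = "\<lambda>v. t1 (u1 (u0 (t0 v)))"])
      (simp_all add: Vector_Spaces.linear_iff V.vector_space_axioms u0.add u0.scale t0.add t0.scale
        t1.add t1.scale u1.add u1.scale u0.diff u1.diff t1.diff t0_ends u0_ends t0_blocks u0_blocks
        u1_a u1_aD)

  define oper where "oper = case_gen t0 u0 t1 u1"
  have linear_oper: "Vector_Spaces.linear scale scale (oper g)" for g
    using t0 u0 t1 u1 by (cases g) (simp_all add: oper_def)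
  have u0_eq: "u0 (u0 v) = u0 v" for v
    using u0_idempotent[of v] by (rule eq_iff_diff_eq_0[THEN iffD2])
  have gen_ops: "generator_operators scale oper"
    by (intro generator_operators.intro generator_operators_axioms.intro V.vector_space_axioms
        linear_oper)
  have "H_operators_axioms scale oper r0 r1"
    unfolding oper_def
    by (rule H_operators_axioms.intro)
      (simp_all only: gen.case t0_quadratic t1_quadratic u0_eq u1_square_zero u0t0t1u1 t1u1u0t0)
  with gen_ops interpret H: H_operators scale oper r0 r1 by (rule H_operators.intro)
  have H_act: "H.H_act (H_gen r0 r1 Gen_t0) = t0" "H.H_act (H_gen r0 r1 Gen_u0) = u0"
    "H.H_act (H_gen r0 r1 Gen_t1) = t1" "H.H_act (H_gen r0 r1 Gen_u1) = u1"
    unfolding H.H_act_gen by (simp_all add: oper_def)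
  show ?thesis
    using H.H_act_module t0_rep u0_rep t1_rep u1_rep
    by (intro exI[of _ H.H_act]) (simp add: H_act)
qed

end
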